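(* The duality-based optimality cuts for the recourse problem without proportional vehicle assignment (RPWoPA) are valid inequalities for the recourse problem with proportional vehicle assignment (RPWPA). That is, let $d\in\mathcal{D}$ and, for each $i\in\mathcal{I}$ and $n=1,\ldots,N_d$, let $\big((\alpha^{nd}_{ijl})_{j\in\mathcal{J}_i,l\in\mathcal{L}},\beta^{nd}_i\big)$ be an extreme point of the dual feasible region $$\{(\alpha,\beta):\ \alpha_{jl}+\beta\ge P_{ijl},\ \alpha_{jl}\ge 0\ \ \forall(j,l)\in\mathcal{J}_i\times\mathcal{L},\ \beta\ge 0\}.$$ Then for every $(x,s)\in\mathcal{C}$, $$Q^{RPWPA}(x,s)\le\sum_{i\in\mathcal{I}}\sum_{n=1}^{N_d}\pi^{nd}\Big(\sum_{(j,l)\in\mathcal{J}_i\times\mathcal{L}}\alpha^{nd}_{ijl}\xi^{nd}_{ij}x_{\zeta(i),\zeta(j),l}+\beta^{nd}_i\sum_{v\in\mathcal{V}}s_{vi}\Big)+U\Big(|\mathcal{Z}|^2-\sum_{z_1\in\mathcal{Z}}\sum_{z_2\in\mathcal{Z}}x_{z_1,z_2,l(z_1,z_2,d)}\Big).$$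
   Context: $\mathcal{I}$ (stations), $\mathcal{Z}$ (zones), $\mathcal{L}$ (price levels), $\mathcal{V}$ (vehicles) are finite nonempty sets. $\mathcal{A}=\{(i,j): i,j\in\mathcal{I},\ i\ne j\}$. The stations are partitioned into zones, and $\zeta:\mathcal{I}\to\mathcal{Z}$ maps a station to its zone. $\mathcal{J}_i=\{j\in\mathcal{I}:(i,j)\in\mathcal{A}\}$. $P_{ijl}\ge 0$ is the rental price from $i$ to $j$ at level $l$. $\mathcal{C}$ is the set of pairs $(x,s)$ with $x\in\{0,1\}^{|\mathcal{Z}|\times|\mathcal{Z}|\times|\mathcal{L}|}$ and $s\in\{0,1\}^{|\mathcal{V}|\times|\mathcal{I}|}$ such that $\sum_{l}x_{z_1,z_2,l}=1$ for all $z_1,z_2\in\mathcal{Z}$ and $\sum_{i}s_{vi}=1$ for all $v\in\mathcal{V}$. Let $\mathcal{X}$ be the finite set of all $x$ satisfying the first family of equalities, listed as $x_d$, $d\in\mathcal{D}=\{1,\ldots,|\mathcal{X}|\}$, and let $\mathcal{C}_d=\{(x,s)\in\mathcal{C}:x=x_d\}$. For $d\in\mathcal{D}$, $l(z_1,z_2,d)$ is the unique $l$ with $(x_d)_{z_1,z_2,l}=1$. To each $d$ corresponds a demand distribution with finite support $\{\xi^{nd}\}_{n=1}^{N_d}\subset\mathbb{Z}^{|\mathcal{A}|}_{\ge 0}$ and probabilities $\pi^{nd}$. For $\xi\in\mathbb{Z}_{\ge0}^{|\mathcal{A}|}$, $Q^{RPWoPA}(x,s,\xi)$ is the optimal value of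 $$\max\sum_{(i,j)\in\mathcal{A}}\sum_{l\in\mathcal{L}}P_{ijl}r_{ijl}\ \text{ s.t. }\ r_{ijl}\le\xi_{ij}x_{\zeta(i),\zeta(j),l}\ \ \forall(i,j)\in\mathcal{A},\,l\in\mathcal{L};\quad\sum_{(j,l)\in\mathcal{J}_i\times\mathcal{L}}r_{ijl}\le\sum_{v\in\mathcal{V}}s_{vi}\ \ \forall i\in\mathcal{I};\quad r_{ijl}\in\mathbb{Z}_{\ge0}.$$ $Q^{RPWPA}(x,s,\xi)$ is the optimal value of the same problem with the additional constraints $r_{ijl}\le\theta_{ij}\sum_{v\in\mathcal{V}}s_{vi}+1$ for all $(i,j)\in\mathcal{A}$, $l\in\mathcal{L}$, where $\theta_{ij}=\xi_{ij}/\sum_{k\in\mathcal{I},k\ne i}\xi_{ik}$ (with $\theta_{ij}=0$ if the denominator is $0$). For $(x,s)\in\mathcal{C}_d$, $Q^{RPWPA}(x,s)=\sum_{n=1}^{N_d}\pi^{nd}Q^{RPWPA}(x,s,\xi^{nd})$, and similarly for $Q^{RPWoPA}(x,s)$. $U$ is a finite constant large enough that each cut is redundant for RPWoPA outside the subregion of its own distribution: for every $d\in\mathcal{D}$, every choice of dual extreme points as in the claim, and every $(x,s)\in\mathcal{C}\setminus\mathcal{C}_d$, the right-hand side of the inequality in the claim is at least $Q^{RPWoPA}(x,s)$. *)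

theory Defs
  imports "HOL-Analysis.Analysis"
begin

text \<open>
  Stations, zones, price levels and vehicles are the finite (hence nonempty) types
  \<open>'i\<close>, \<open>'z\<close>, \<open>'l\<close>, \<open>'v\<close>. Quantities indexed by arcs \<open>(i, j)\<close> are curried functions that are
  also defined at \<open>i = j\<close>; every definition below reads them only at \<open>i \<noteq> j\<close>.
\<close>

type_synonym ('z, 'l) pricing = "'z \<Rightarrow> 'z \<Rightarrow> 'l \<Rightarrow> nat"
type_synonym ('v, 'i) assignment = "'v \<Rightarrow> 'i \<Rightarrow> nat"
type_synonym 'i demand = "'i \<Rightarrow> 'i \<Rightarrow> nat"

definition arcs :: "('i::finite \<times> 'i) set" where
  "arcs = {(i, j). i \<noteq> j}"

definition dests :: "'i::finite \<Rightarrow> 'i set" where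
  "dests i = {j. (i, j) \<in> arcs}"

definition pricings :: "('z::finite, 'l::finite) pricing set" where
  "pricings = {x. (\<forall>z1 z2 l. x z1 z2 l \<in> {0, 1}) \<and> (\<forall>z1 z2. (\<Sum>l\<in>UNIV. x z1 z2 l) = 1)}"

definition assignments :: "('v::finite, 'i::finite) assignment set" where
  "assignments = {s. (\<forall>v i. s v i \<in> {0, 1}) \<and> (\<forall>v. (\<Sum>i\<in>UNIV. s v i) = 1)}"

definition first_stage ::
  "(('z::finite, 'l::finite) pricing \<times> ('v::finite, 'i::finite) assignment) set" where
  "first_stage = {(x, s). x \<in> pricings \<and> s \<in> assignments}"


subsection \<open>The recourse problems\<close>

definition theta :: "'i::finite demand \<Rightarrow> 'i \<Rightarrow> 'i \<Rightarrow> real" where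
  \<comment> \<open>if the denominator is \<open>0\<close>, so is the quotient, because \<open>a / 0 = 0\<close> in HOL\<close>
  "theta \<xi> i j = real (\<xi> i j) / real (\<Sum>k\<in>{k. k \<noteq> i}. \<xi> i k)"

definition feasible_woPA ::
  "('i::finite \<Rightarrow> 'z::finite) \<Rightarrow> ('z, 'l::finite) pricing \<Rightarrow> ('v::finite, 'i) assignment \<Rightarrow>
   'i demand \<Rightarrow> ('i \<Rightarrow> 'i \<Rightarrow> 'l \<Rightarrow> nat) set" where
  "feasible_woPA \<zeta> x s \<xi> =
     {r. (\<forall>(i, j)\<in>arcs. \<forall>l. r i j l \<le> \<xi> i j * x (\<zeta> i) (\<zeta> j) l) \<and>
         (\<forall>i. (\<Sum>(j, l)\<in>dests i \<times> UNIV. r i j l) \<le> (\<Sum>v\<in>UNIV. s v i))}"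

definition feasible_PA ::
  "('i::finite \<Rightarrow> 'z::finite) \<Rightarrow> ('z, 'l::finite) pricing \<Rightarrow> ('v::finite, 'i) assignment \<Rightarrow>
   'i demand \<Rightarrow> ('i \<Rightarrow> 'i \<Rightarrow> 'l \<Rightarrow> nat) set" where
  "feasible_PA \<zeta> x s \<xi> =
     {r \<in> feasible_woPA \<zeta> x s \<xi>.
        \<forall>(i, j)\<in>arcs. \<forall>l. real (r i j l) \<le> theta \<xi> i j * real (\<Sum>v\<in>UNIV. s v i) + 1}"

definition revenue ::
  "('i::finite \<Rightarrow> 'i \<Rightarrow> 'l::finite \<Rightarrow> real) \<Rightarrow> ('i \<Rightarrow> 'i \<Rightarrow> 'l \<Rightarrow> nat) \<Rightarrow> real" where
  "revenue P r = (\<Sum>(i, j)\<in>arcs. \<Sum>l\<in>UNIV. P i j l * real (r i j l))"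

text \<open>The suprema below are attained: see \<open>Q_woPA_attained\<close> and \<open>Q_PA_attained\<close>.\<close>

definition Q_woPA ::
  "('i::finite \<Rightarrow> 'i \<Rightarrow> 'l::finite \<Rightarrow> real) \<Rightarrow> ('i \<Rightarrow> 'z::finite) \<Rightarrow> ('z, 'l) pricing \<Rightarrow>
   ('v::finite, 'i) assignment \<Rightarrow> 'i demand \<Rightarrow> real" where
  "Q_woPA P \<zeta> x s \<xi> = (SUP r\<in>feasible_woPA \<zeta> x s \<xi>. revenue P r)"

definition Q_PA ::
  "('i::finite \<Rightarrow> 'i \<Rightarrow> 'l::finite \<Rightarrow> real) \<Rightarrow> ('i \<Rightarrow> 'z::finite) \<Rightarrow> ('z, 'l) pricing \<Rightarrow>
   ('v::finite, 'i) assignment \<Rightarrow> 'i demand \<Rightarrow> real" where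
  "Q_PA P \<zeta> x s \<xi> = (SUP r\<in>feasible_PA \<zeta> x s \<xi>. revenue P r)"

lemma revenue_values_finite:
  "finite (revenue P ` feasible_woPA \<zeta> x s \<xi>)"
proof -
  define S where "S i j l = {..\<xi> i j * x (\<zeta> i) (\<zeta> j) l}" for i j l
  define T where "T = {r. \<forall>i j l. r i j l \<in> S i j l}"
  have "T = Pi UNIV (\<lambda>i. Pi UNIV (\<lambda>j. Pi UNIV (S i j)))"
    by (auto simp: T_def Pi_def)
  moreover have "finite (Pi UNIV (\<lambda>i. Pi UNIV (\<lambda>j. Pi UNIV (S i j))))"
    by (simp add: S_def finite_PiE flip: PiE_UNIV_domain)
  ultimately have "finite T" by simp
  moreover have "revenue P ` feasible_woPA \<zeta> x s \<xi> \<subseteq> revenue P ` T"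
  proof
    fix y assume "y \<in> revenue P ` feasible_woPA \<zeta> x s \<xi>"
    then obtain r where r: "r \<in> feasible_woPA \<zeta> x s \<xi>" "y = revenue P r" by blast
    define r' where "r' i j l = (if i = j then 0 else r i j l)" for i j l
    have "r' \<in> T" using r by (auto simp: T_def S_def r'_def feasible_woPA_def arcs_def)
    moreover have "revenue P r' = revenue P r"
      unfolding revenue_def by (rule sum.cong) (auto simp: r'_def arcs_def)
    ultimately show "y \<in> revenue P ` T" using r(2) by (metis image_eqI)
  qed
  ultimately show ?thesis by (meson finite_imageI finite_subset)
qed

lemma Sup_image_attained:
  fixes f :: "'a \<Rightarrow> real"
  assumes "finite (f ` F)" "F \<noteq> {}"
  shows "\<exists>r\<in>F. (SUP r\<in>F. f r) = f r \<and> (\<forall>r'\<in>F. f r' \<le> f r)"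
proof -
  have *: "Sup (f ` F) = Max (f ` F)" using assms by (intro cSup_eq_Max) auto
  have "Max (f ` F) \<in> f ` F" using assms by (intro Max_in) auto
  then obtain r where "r \<in> F" "Max (f ` F) = f r" by blast
  moreover have "\<forall>r'\<in>F. f r' \<le> Max (f ` F)" using assms by (auto intro: Max_ge)
  ultimately show ?thesis using * by metis
qed

lemma Q_woPA_attained:
  "\<exists>r\<in>feasible_woPA \<zeta> x s \<xi>.
     Q_woPA P \<zeta> x s \<xi> = revenue P r \<and> (\<forall>r'\<in>feasible_woPA \<zeta> x s \<xi>. revenue P r' \<le> revenue P r)"
proof -
  have "(\<lambda>_ _ _. 0) \<in> feasible_woPA \<zeta> x s \<xi>" by (simp add: feasible_woPA_def)
  then show ?thesis
    unfolding Q_woPA_def by (intro Sup_image_attained revenue_values_finite) auto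
qed

lemma Q_PA_attained:
  "\<exists>r\<in>feasible_PA \<zeta> x s \<xi>.
     Q_PA P \<zeta> x s \<xi> = revenue P r \<and> (\<forall>r'\<in>feasible_PA \<zeta> x s \<xi>. revenue P r' \<le> revenue P r)"
proof -
  have "(\<lambda>_ _ _. 0) \<in> feasible_PA \<zeta> x s \<xi>"
    by (auto simp: feasible_PA_def feasible_woPA_def theta_def simp flip: of_nat_sum
             intro!: add_nonneg_nonneg mult_nonneg_nonneg)
  moreover have "finite (revenue P ` feasible_PA \<zeta> x s \<xi>)"
    by (rule finite_subset[OF _ revenue_values_finite]) (auto simp: feasible_PA_def)
  ultimately show ?thesis
    unfolding Q_PA_def by (intro Sup_image_attained) auto
qed


subsection \<open>Expected recourse under pricing-dependent demand\<close>

text \<open>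
  \<open>xs\<close> lists the pricings as \<open>xs d\<close>, \<open>d \<in> {1..card pricings}\<close>. The demand distribution attached to
  \<open>d\<close> takes the value \<open>\<xi> d n\<close> with probability \<open>p d n\<close>, \<open>n \<in> {1..N d}\<close>.
\<close>

definition listing :: "(nat \<Rightarrow> ('z::finite, 'l::finite) pricing) \<Rightarrow> bool" where
  "listing xs \<longleftrightarrow> bij_betw xs {1..card (pricings :: ('z, 'l) pricing set)} pricings"

definition index_of ::
  "(nat \<Rightarrow> ('z::finite, 'l::finite) pricing) \<Rightarrow> ('z, 'l) pricing \<Rightarrow> nat" where
  "index_of xs x = (THE d. d \<in> {1..card (pricings :: ('z, 'l) pricing set)} \<and> xs d = x)"

definition first_stage_at ::
  "(nat \<Rightarrow> ('z::finite, 'l::finite) pricing) \<Rightarrow> nat \<Rightarrow>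
   (('z, 'l) pricing \<times> ('v::finite, 'i::finite) assignment) set" where
  "first_stage_at xs d = {(x, s) \<in> first_stage. x = xs d}"

definition level ::
  "(nat \<Rightarrow> ('z::finite, 'l::finite) pricing) \<Rightarrow> 'z \<Rightarrow> 'z \<Rightarrow> nat \<Rightarrow> 'l" where
  "level xs z1 z2 d = (THE l. xs d z1 z2 l = 1)"

definition EQ_woPA ::
  "('i::finite \<Rightarrow> 'i \<Rightarrow> 'l::finite \<Rightarrow> real) \<Rightarrow> ('i \<Rightarrow> 'z::finite) \<Rightarrow> (nat \<Rightarrow> ('z, 'l) pricing) \<Rightarrow>
   (nat \<Rightarrow> nat) \<Rightarrow> (nat \<Rightarrow> nat \<Rightarrow> 'i demand) \<Rightarrow> (nat \<Rightarrow> nat \<Rightarrow> real) \<Rightarrow>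
   ('z, 'l) pricing \<Rightarrow> ('v::finite, 'i) assignment \<Rightarrow> real" where
  "EQ_woPA P \<zeta> xs N \<xi> p x s =
     (let d = index_of xs x in \<Sum>n=1..N d. p d n * Q_woPA P \<zeta> x s (\<xi> d n))"

definition EQ_PA ::
  "('i::finite \<Rightarrow> 'i \<Rightarrow> 'l::finite \<Rightarrow> real) \<Rightarrow> ('i \<Rightarrow> 'z::finite) \<Rightarrow> (nat \<Rightarrow> ('z, 'l) pricing) \<Rightarrow>
   (nat \<Rightarrow> nat) \<Rightarrow> (nat \<Rightarrow> nat \<Rightarrow> 'i demand) \<Rightarrow> (nat \<Rightarrow> nat \<Rightarrow> real) \<Rightarrow>
   ('z, 'l) pricing \<Rightarrow> ('v::finite, 'i) assignment \<Rightarrow> real" where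
  "EQ_PA P \<zeta> xs N \<xi> p x s =
     (let d = index_of xs x in \<Sum>n=1..N d. p d n * Q_PA P \<zeta> x s (\<xi> d n))"


subsection \<open>Duality-based optimality cuts\<close>

text \<open>
  The dual region of station \<open>i\<close> lives in the space of vectors indexed by \<open>dests i \<times> UNIV\<close> (plus one
  coordinate for \<open>\<beta>\<close>). That space is realised as the coordinate subspace \<open>\<alpha> $ i = 0\<close> of a space
  not depending on \<open>i\<close>; without this equation the region would contain lines and
  have no extreme points.
\<close>

definition dual_region ::
  "('i::finite \<Rightarrow> 'i \<Rightarrow> 'l::finite \<Rightarrow> real) \<Rightarrow> 'i \<Rightarrow> ((real^'l^'i) \<times> real) set" where
  "dual_region P i =
     {(\<alpha>, \<beta>). (\<forall>(j, l)\<in>dests i \<times> UNIV. \<alpha> $ j $ l + \<beta> \<ge> P i j l \<and> \<alpha> $ j $ l \<ge> 0) \<and> \<beta> \<ge> 0 \<and>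
             \<alpha> $ i = 0}"

definition dual_choice ::
  "('i::finite \<Rightarrow> 'i \<Rightarrow> 'l::finite \<Rightarrow> real) \<Rightarrow> nat \<Rightarrow>
   (nat \<Rightarrow> 'i \<Rightarrow> real^'l^'i) \<Rightarrow> (nat \<Rightarrow> 'i \<Rightarrow> real) \<Rightarrow> bool" where
  "dual_choice P m \<alpha> \<beta> \<longleftrightarrow>
     (\<forall>i. \<forall>n\<in>{1..m}. (\<alpha> n i, \<beta> n i) extreme_point_of dual_region P i)"

definition cut_rhs ::
  "('i::finite \<Rightarrow> 'z::finite) \<Rightarrow> (nat \<Rightarrow> ('z, 'l::finite) pricing) \<Rightarrow>
   (nat \<Rightarrow> nat) \<Rightarrow> (nat \<Rightarrow> nat \<Rightarrow> 'i demand) \<Rightarrow> (nat \<Rightarrow> nat \<Rightarrow> real) \<Rightarrow> real \<Rightarrow>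
   nat \<Rightarrow> (nat \<Rightarrow> 'i \<Rightarrow> real^'l^'i) \<Rightarrow> (nat \<Rightarrow> 'i \<Rightarrow> real) \<Rightarrow>
   ('z, 'l) pricing \<Rightarrow> ('v::finite, 'i) assignment \<Rightarrow> real" where
  "cut_rhs \<zeta> xs N \<xi> p U d \<alpha> \<beta> x s =
     (\<Sum>i\<in>UNIV. \<Sum>n=1..N d. p d n *
        ((\<Sum>(j, l)\<in>dests i \<times> UNIV. \<alpha> n i $ j $ l * real (\<xi> d n i j) * real (x (\<zeta> i) (\<zeta> j) l))
         + \<beta> n i * real (\<Sum>v\<in>UNIV. s v i)))
     + U * (real CARD('z)^2 - real (\<Sum>z1\<in>UNIV. \<Sum>z2\<in>UNIV. x z1 z2 (level xs z1 z2 d)))"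

end

theory Submission
  imports Defs
begin

text \<open>
  Proportional assignment only adds constraints to the recourse problem, so its optimal value is at
  most the one without proportional assignment, scenario by scenario and hence in expectation
  (\<open>EQ_PA_le_EQ_woPA\<close>). It therefore suffices that the cut bounds the expected recourse without
  proportional assignment.

  Away from the pricing \<open>xs d\<close> this is exactly what the choice of \<open>U\<close> guarantees. At \<open>x = xs d\<close> the
  \<open>U\<close>-term vanishes, since \<open>x\<close> selects the level \<open>level xs z1 z2 d\<close> for each of the
  \<open>CARD('z)\<^sup>2\<close> pairs of zones (\<open>sum_at_own_levels\<close>). What remains of the cut is an expectation of
  dual objective values, because the recourse problem splits by station of origin. Integral rentals
  are feasible for the linear relaxation, so weak duality at each station finishes the proof
  (\<open>Q_woPA_le_dual_value\<close>).
\<close>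

lemma Q_PA_le_Q_woPA: "Q_PA P \<zeta> x s \<xi> \<le> Q_woPA P \<zeta> x s \<xi>"
proof -
  obtain r where "r \<in> feasible_PA \<zeta> x s \<xi>" "Q_PA P \<zeta> x s \<xi> = revenue P r"
    using Q_PA_attained by blast
  moreover have "feasible_PA \<zeta> x s \<xi> \<subseteq> feasible_woPA \<zeta> x s \<xi>"
    by (auto simp: feasible_PA_def)
  ultimately show ?thesis
    using Q_woPA_attained by (metis subsetD)
qed

lemma index_of_eq:
  fixes xs :: "nat \<Rightarrow> ('z::finite, 'l::finite) pricing"
  assumes "listing xs" "d \<in> {1..card (pricings :: ('z, 'l) pricing set)}"
  shows "index_of xs (xs d) = d"
  using assms unfolding index_of_def listing_def bij_betw_def
  by (intro the_equality) (auto dest: inj_onD)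

lemma index_of_in_range:
  fixes xs :: "nat \<Rightarrow> ('z::finite, 'l::finite) pricing"
  assumes "listing xs" "x \<in> pricings"
  shows "index_of xs x \<in> {1..card (pricings :: ('z, 'l) pricing set)}"
proof -
  obtain d where "d \<in> {1..card (pricings :: ('z, 'l) pricing set)}" "x = xs d"
    using assms unfolding listing_def bij_betw_def by blast
  then show ?thesis
    using index_of_eq[OF assms(1)] by metis
qed

lemma EQ_PA_le_EQ_woPA:
  fixes xs :: "nat \<Rightarrow> ('z::finite, 'l::finite) pricing"
  assumes "listing xs" "x \<in> pricings"
    and "\<forall>d\<in>{1..card (pricings :: ('z, 'l) pricing set)}. \<forall>n\<in>{1..N d}. p d n \<ge> 0"
  shows "EQ_PA P \<zeta> xs N \<xi> p x s \<le> EQ_woPA P \<zeta> xs N \<xi> p x s"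
  using assms(3) index_of_in_range[OF assms(1,2)]
  unfolding EQ_PA_def EQ_woPA_def Let_def
  by (intro sum_mono mult_left_mono Q_PA_le_Q_woPA) blast

lemma pricing_selects_unique_level:
  fixes x :: "('z::finite, 'l::finite) pricing"
  assumes "x \<in> pricings"
  shows "\<exists>!l. x z1 z2 l = 1"
proof -
  have total: "(\<Sum>l\<in>UNIV. x z1 z2 l) = 1"
    using assms by (simp add: pricings_def)
  then show ?thesis
    using sum_eq_1_iff[of UNIV "x z1 z2"] by (metis UNIV_I finite zero_neq_one)
qed

lemma sum_at_own_levels:
  fixes xs :: "nat \<Rightarrow> ('z::finite, 'l::finite) pricing"
  assumes "xs d \<in> pricings"
  shows "(\<Sum>z1\<in>UNIV. \<Sum>z2\<in>UNIV. xs d z1 z2 (level xs z1 z2 d)) = CARD('z)^2"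
proof -
  have "xs d z1 z2 (level xs z1 z2 d) = 1" for z1 z2
    unfolding level_def using pricing_selects_unique_level[OF assms] by (rule theI')
  then show ?thesis
    by (simp add: power2_eq_square)
qed

lemma revenue_by_origin:
  fixes P :: "'i::finite \<Rightarrow> 'i \<Rightarrow> 'l::finite \<Rightarrow> real"
  shows "revenue P r = (\<Sum>i\<in>UNIV. \<Sum>(j, l)\<in>dests i \<times> UNIV. P i j l * real (r i j l))"
proof -
  have "(arcs :: ('i \<times> 'i) set) = Sigma UNIV dests"
    by (auto simp: dests_def)
  then have "revenue P r = (\<Sum>(i, j)\<in>Sigma UNIV dests. \<Sum>l\<in>UNIV. P i j l * real (r i j l))"
    by (simp only: revenue_def)
  then show ?thesis
    by (simp add: sum.Sigma[symmetric] sum.cartesian_product[symmetric])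
qed

text \<open>
  This is weak duality for one station, for an arbitrary index set \<open>K\<close> of rentals: \<open>r\<close> is the rental
  vector, \<open>u\<close> its upper bounds with multipliers \<open>a\<close>, and \<open>b\<close> is the multiplier of the capacity \<open>S\<close>.
\<close>

lemma station_weak_duality:
  fixes c a r u :: "'k \<Rightarrow> real"
  assumes dual: "\<And>k. k \<in> K \<Longrightarrow> c k \<le> a k + b" "\<And>k. k \<in> K \<Longrightarrow> 0 \<le> a k" "0 \<le> b"
    and primal: "\<And>k. k \<in> K \<Longrightarrow> 0 \<le> r k" "\<And>k. k \<in> K \<Longrightarrow> r k \<le> u k" "sum r K \<le> S"
  shows "(\<Sum>k\<in>K. c k * r k) \<le> (\<Sum>k\<in>K. a k * u k) + b * S"
proof -
  have "(\<Sum>k\<in>K. c k * r k) \<le> (\<Sum>k\<in>K. (a k + b) * r k)"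
    using dual(1) primal(1) by (intro sum_mono mult_right_mono) auto
  also have "\<dots> = (\<Sum>k\<in>K. a k * r k) + b * sum r K"
    by (simp add: distrib_right sum.distrib sum_distrib_left)
  also have "\<dots> \<le> (\<Sum>k\<in>K. a k * u k) + b * S"
    using dual(2,3) primal(2,3) by (intro add_mono sum_mono mult_left_mono) auto
  finally show ?thesis .
qed

lemma Q_woPA_le_dual_value:
  fixes \<alpha> :: "'i::finite \<Rightarrow> real^'l::finite^'i"
  assumes dual: "\<And>i. (\<alpha> i, \<beta> i) \<in> dual_region P i"
  shows "Q_woPA P \<zeta> x s \<xi> \<le>
    (\<Sum>i\<in>UNIV. (\<Sum>(j, l)\<in>dests i \<times> UNIV. \<alpha> i $ j $ l * real (\<xi> i j) * real (x (\<zeta> i) (\<zeta> j) l))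
                + \<beta> i * real (\<Sum>v\<in>UNIV. s v i))"
    (is "_ \<le> (\<Sum>i\<in>UNIV. ?dual i)")
proof -
  obtain r where r: "r \<in> feasible_woPA \<zeta> x s \<xi>" and Q: "Q_woPA P \<zeta> x s \<xi> = revenue P r"
    using Q_woPA_attained by blast
  have "(\<Sum>(j, l)\<in>dests i \<times> UNIV. P i j l * real (r i j l)) \<le> ?dual i" for i
  proof -
    have bound: "real (r i j l) \<le> real (\<xi> i j) * real (x (\<zeta> i) (\<zeta> j) l)" if "j \<in> dests i" for j l
    proof -
      have "r i j l \<le> \<xi> i j * x (\<zeta> i) (\<zeta> j) l"
        using r that by (auto simp: feasible_woPA_def dests_def)
      then show ?thesis
        by (metis of_nat_le_iff of_nat_mult)
    qed
    have "(\<Sum>(j, l)\<in>dests i \<times> UNIV. r i j l) \<le> (\<Sum>v\<in>UNIV. s v i)"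
      using r by (simp add: feasible_woPA_def)
    then have "real (\<Sum>(j, l)\<in>dests i \<times> UNIV. r i j l) \<le> real (\<Sum>v\<in>UNIV. s v i)"
      by (rule of_nat_mono)
    then have capacity:
      "(\<Sum>k\<in>dests i \<times> UNIV. real (r i (fst k) (snd k))) \<le> real (\<Sum>v\<in>UNIV. s v i)"
      by (simp add: case_prod_unfold)
    show ?thesis
      using station_weak_duality[of "dests i \<times> UNIV" "\<lambda>k. P i (fst k) (snd k)"
          "\<lambda>k. \<alpha> i $ fst k $ snd k" "\<beta> i" "\<lambda>k. real (r i (fst k) (snd k))"
          "\<lambda>k. real (\<xi> i (fst k)) * real (x (\<zeta> i) (\<zeta> (fst k)) (snd k))"
          "real (\<Sum>v\<in>UNIV. s v i)"]
        dual[of i] bound capacity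
      by (fastforce simp: dual_region_def case_prod_unfold mult.assoc)
  qed
  then show ?thesis
    unfolding Q revenue_by_origin by (rule sum_mono)
qed

theorem proposition3p5:
  fixes P :: "'i::finite \<Rightarrow> 'i \<Rightarrow> 'l::finite \<Rightarrow> real"
    and \<zeta> :: "'i \<Rightarrow> 'z::finite"
    and xs :: "nat \<Rightarrow> ('z, 'l) pricing"
    and N :: "nat \<Rightarrow> nat"
    and \<xi> :: "nat \<Rightarrow> nat \<Rightarrow> 'i demand"
    and p :: "nat \<Rightarrow> nat \<Rightarrow> real"
    and U :: real
    and d :: nat
    and \<alpha> :: "nat \<Rightarrow> 'i \<Rightarrow> real^'l^'i"
    and \<beta> :: "nat \<Rightarrow> 'i \<Rightarrow> real"
    and x :: "('z, 'l) pricing"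
    and s :: "('v::finite, 'i) assignment"
  assumes P_nonneg: "\<forall>(i, j)\<in>arcs. \<forall>l. P i j l \<ge> 0"
    and xs: "listing xs"
    and prob_nonneg:
      "\<forall>d'\<in>{1..card (pricings :: ('z, 'l) pricing set)}. \<forall>n\<in>{1..N d'}. p d' n \<ge> 0"
    and prob_sum:
      "\<forall>d'\<in>{1..card (pricings :: ('z, 'l) pricing set)}. (\<Sum>n=1..N d'. p d' n) = 1"
    and U_large:
      "\<forall>d'\<in>{1..card (pricings :: ('z, 'l) pricing set)}. \<forall>\<alpha>' \<beta>'. dual_choice P (N d') \<alpha>' \<beta>' \<longrightarrow>
         (\<forall>(x', s') \<in> first_stage - first_stage_at xs d'.
            cut_rhs \<zeta> xs N \<xi> p U d' \<alpha>' \<beta>' x' (s' :: ('v, 'i) assignment)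
              \<ge> EQ_woPA P \<zeta> xs N \<xi> p x' s')"
    and d: "d \<in> {1..card (pricings :: ('z, 'l) pricing set)}"
    and dual: "dual_choice P (N d) \<alpha> \<beta>"
    and first_stage: "(x, s) \<in> first_stage"
  shows "EQ_PA P \<zeta> xs N \<xi> p x s \<le> cut_rhs \<zeta> xs N \<xi> p U d \<alpha> \<beta> x s"
proof (cases "x = xs d")
  case True
  have x: "x \<in> pricings"
    using first_stage by (simp add: first_stage_def)
  define V where "V n i =
      (\<Sum>(j, l)\<in>dests i \<times> UNIV. \<alpha> n i $ j $ l * real (\<xi> d n i j) * real (x (\<zeta> i) (\<zeta> j) l))
       + \<beta> n i * real (\<Sum>v\<in>UNIV. s v i)" for n i
  have "EQ_PA P \<zeta> xs N \<xi> p x s \<le> EQ_woPA P \<zeta> xs N \<xi> p x s"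
    using xs x prob_nonneg by (rule EQ_PA_le_EQ_woPA)
  also have "\<dots> = (\<Sum>n=1..N d. p d n * Q_woPA P \<zeta> x s (\<xi> d n))"
    using True index_of_eq[OF xs d] by (simp add: EQ_woPA_def)
  also have "\<dots> \<le> (\<Sum>n=1..N d. p d n * (\<Sum>i\<in>UNIV. V n i))"
  proof (intro sum_mono mult_left_mono)
    fix n assume n: "n \<in> {1..N d}"
    have "(\<alpha> n i, \<beta> n i) \<in> dual_region P i" for i
      using dual n by (auto simp: dual_choice_def extreme_point_of_def)
    then show "Q_woPA P \<zeta> x s (\<xi> d n) \<le> (\<Sum>i\<in>UNIV. V n i)"
      unfolding V_def by (rule Q_woPA_le_dual_value)
    show "0 \<le> p d n"
      using prob_nonneg d n by blast
  qed
  also have "\<dots> = (\<Sum>i\<in>UNIV. \<Sum>n=1..N d. p d n * V n i)"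
    unfolding sum_distrib_left by (rule sum.swap)
  also have "\<dots> = cut_rhs \<zeta> xs N \<xi> p U d \<alpha> \<beta> x s"
  proof -
    have "(\<Sum>z1\<in>UNIV. \<Sum>z2\<in>UNIV. x z1 z2 (level xs z1 z2 d)) = CARD('z)^2"
      using sum_at_own_levels[of xs d] x True by simp
    then show ?thesis
      unfolding cut_rhs_def V_def by (simp del: of_nat_sum)
  qed
  finally show ?thesis .
next
  case False
  then have "(x, s) \<in> first_stage - first_stage_at xs d"
    using first_stage by (simp add: first_stage_at_def)
  then have "EQ_woPA P \<zeta> xs N \<xi> p x s \<le> cut_rhs \<zeta> xs N \<xi> p U d \<alpha> \<beta> x s"
    using U_large d dual by blast
  moreover have "EQ_PA P \<zeta> xs N \<xi> p x s \<le> EQ_woPA P \<zeta> xs N \<xi> p x s"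
    using xs first_stage prob_nonneg by (intro EQ_PA_le_EQ_woPA) (auto simp: first_stage_def)
  ultimately show ?thesis by linarith
qed

end
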